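(* Let $G = F_{n_k} \rtimes F_{n_{k-1}} \rtimes \cdots \rtimes F_{n_1}$ be an almost-direct product of free groups, with a Magnus-type ordering with positive cone $\mathcal{P}(F_{n_i})$ fixed on each free factor $F_{n_i}$. Let $P \subset G$ be the set of all $g$ with normal form $g = g_k\cdots g_1$ ($g_i \in F_{n_i}$) for which there is $j \in \{1,\dots,k\}$ with $g_j \in \mathcal{P}(F_{n_j})$ and $g_i = 1$ for all $i > j$, and let $<$ be the lexicographic ordering on $G$ defined by $P$, i.e. $g<h \iff g^{-1}h\in P$. Then for each $1 \leq j \leq k$ the subgroup $$G_j = F_{n_j} \rtimes F_{n_{j-1}} \rtimes \cdots \rtimes F_{n_1}$$ is convex in $G$ with respect to $<$.
   Context: Almost-direct products. Let $F_{n_1},\dots,F_{n_k}$ be free groups of finite ranks $n_1,\dots,n_k$. The iterated semidirect product $G = F_{n_k} \rtimes \cdots \rtimes F_{n_1}$ is read as follows: $G_1 = F_{n_1}$, $G_i = F_{n_i} \rtimes G_{i-1}$ for $i \ge 2$ (so $F_{n_i}$ is normal in $G_i$ and $G_{i-1}$ acts on $F_{n_i}$), and $G = G_k$. It is an almost-direct product of free groups if for each $i\ge 2$ the action of $G_{i-1}$ on $F_{n_i}$ induces the trivial action on the abelianization $F_{n_i}/[F_{n_i},F_{n_i}]$. Every $g \in G$ can be written uniquely as $g = g_k g_{k-1}\cdots g_1$ with $g_i \in F_{n_i}$; this is the normal form of $g$. Magnus-type ordering on the free group $F_n$: fix a free basis $x_1,\dots,x_n$ and let $\mu\colon F_n \to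 \mathbb{Z}\langle\langle X_1,\dots,X_n\rangle\rangle$ be the Magnus embedding into the ring of formal power series in noncommuting variables, $\mu(x_i) = 1 + X_i$. Order monomials first by degree and then lexicographically within each degree. An element $g \ne 1$ belongs to the positive cone $\mathcal{P}(F_n)$ iff the coefficient of the smallest monomial occurring with nonzero coefficient in $\mu(g) - 1$ is positive. A subgroup $H$ of an ordered group $(G,<)$ is convex if, whenever $h_1 < g < h_2$ with $h_1,h_2 \in H$ and $g \in G$, then $g \in H$. *)

theory Defs
  imports "HOL-Algebra.Algebra"
begin

section \<open>Free bases\<close>

text \<open>A word is a list of letters; the letter (i, True) stands for the generator \<open>x i\<close> and
  (i, False) for its inverse.\<close>

type_synonym word = "(nat \<times> bool) list"

definition words :: "nat \<Rightarrow> word set" where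
  "words n = {w. fst ` set w \<subseteq> {1..n}}"

definition reduced :: "word \<Rightarrow> bool" where
  "reduced w \<longleftrightarrow> successively (\<lambda>a b. \<not> (fst a = fst b \<and> snd a \<noteq> snd b)) w"

definition letter_val :: "('a, 'b) monoid_scheme \<Rightarrow> (nat \<Rightarrow> 'a) \<Rightarrow> nat \<times> bool \<Rightarrow> 'a" where
  "letter_val H x a = (if snd a then x (fst a) else inv\<^bsub>H\<^esub> (x (fst a)))"

definition word_val :: "('a, 'b) monoid_scheme \<Rightarrow> (nat \<Rightarrow> 'a) \<Rightarrow> word \<Rightarrow> 'a" where
  "word_val H x w = foldr (\<lambda>a g. letter_val H x a \<otimes>\<^bsub>H\<^esub> g) w \<one>\<^bsub>H\<^esub>"

text \<open>The universal property of a free basis is proved below (\<open>free_basis_extension\<close>).\<close>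

definition free_basis :: "('a, 'b) monoid_scheme \<Rightarrow> nat \<Rightarrow> (nat \<Rightarrow> 'a) \<Rightarrow> bool" where
  "free_basis H n x \<longleftrightarrow>
     x \<in> {1..n} \<rightarrow> carrier H \<and>
     generate H (x ` {1..n}) = carrier H \<and>
     (\<forall>w \<in> words n. reduced w \<and> w \<noteq> [] \<longrightarrow> word_val H x w \<noteq> \<one>\<^bsub>H\<^esub>)"

section \<open>Formal power series in noncommuting variables\<close>

text \<open>Integral power series in \<open>n\<close> noncommuting variables. A monomial is the list of the indices
  of its variables, and a series is its coefficient function.\<close>

definition nc_series :: "nat \<Rightarrow> (nat list \<Rightarrow> int) ring" where
  "nc_series n = \<lparr>
     carrier = {f. \<forall>w. f w \<noteq> 0 \<longrightarrow> set w \<subseteq> {1..n}},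
     monoid.mult = (\<lambda>f g w. \<Sum>i\<le>length w. f (take i w) * g (drop i w)),
     one = (\<lambda>w. if w = [] then 1 else 0),
     ring.zero = (\<lambda>w. 0),
     add = (\<lambda>f g w. f w + g w)\<rparr>"

definition nc_var :: "nat \<Rightarrow> nat list \<Rightarrow> int" where
  "nc_var i = (\<lambda>w. if w = [i] then 1 else 0)"

section \<open>The Magnus ordering\<close>

text \<open>Existence and uniqueness of this homomorphism are proved below
  (\<open>magnus_unique_existence\<close>).\<close>

definition magnus :: "('a, 'b) monoid_scheme \<Rightarrow> nat \<Rightarrow> (nat \<Rightarrow> 'a) \<Rightarrow> 'a \<Rightarrow> nat list \<Rightarrow> int" where
  "magnus H n x = (THE \<mu>. \<mu> \<in> hom H (units_of (nc_series n)) \<and> \<mu> \<in> extensional (carrier H) \<and>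
     (\<forall>i\<in>{1..n}. \<mu> (x i) = \<one>\<^bsub>nc_series n\<^esub> \<oplus>\<^bsub>nc_series n\<^esub> nc_var i))"

text \<open>The relation \<open>lenlex less_than\<close> compares monomials first by degree and then
  lexicographically.\<close>

definition magnus_cone :: "('a, 'b) monoid_scheme \<Rightarrow> nat \<Rightarrow> (nat \<Rightarrow> 'a) \<Rightarrow> 'a set" where
  "magnus_cone H n x = {g \<in> carrier H. g \<noteq> \<one>\<^bsub>H\<^esub> \<and>
     (let f = magnus H n x g \<ominus>\<^bsub>nc_series n\<^esub> \<one>\<^bsub>nc_series n\<^esub> in
      \<exists>w. f w > 0 \<and> (\<forall>v. (v, w) \<in> lenlex less_than \<longrightarrow> f v = 0))}"

section \<open>Almost-direct products\<close>

definition internal_semidirect :: "('a, 'b) monoid_scheme \<Rightarrow> 'a set \<Rightarrow> 'a set \<Rightarrow> bool" where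
  "internal_semidirect G N H \<longleftrightarrow>
     N \<lhd> G \<and> subgroup H G \<and> N <#>\<^bsub>G\<^esub> H = carrier G \<and> N \<inter> H = {\<one>\<^bsub>G\<^esub>}"

text \<open>The set \<open>F j \<cdots> F 1\<close>.\<close>

fun stage :: "('a, 'b) monoid_scheme \<Rightarrow> (nat \<Rightarrow> 'a set) \<Rightarrow> nat \<Rightarrow> 'a set" where
  "stage G F 0 = {\<one>\<^bsub>G\<^esub>}"
| "stage G F (Suc j) = F (Suc j) <#>\<^bsub>G\<^esub> stage G F j"

definition iterated_semidirect :: "('a, 'b) monoid_scheme \<Rightarrow> nat \<Rightarrow> (nat \<Rightarrow> 'a set) \<Rightarrow> bool" where
  "iterated_semidirect G k F \<longleftrightarrow>
     group G \<and> 1 \<le> k \<and> (\<forall>i\<in>{1..k}. subgroup (F i) G) \<and> stage G F k = carrier G \<and>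
     (\<forall>i\<in>{2..k}. internal_semidirect (G\<lparr>carrier := stage G F i\<rparr>) (F i) (stage G F (i - 1)))"

text \<open>The action of the lower stage is conjugation, and its action on the abelianization is
  compared on cosets of the commutator subgroup \<open>derived G (F i)\<close>.\<close>

definition almost_direct :: "('a, 'b) monoid_scheme \<Rightarrow> nat \<Rightarrow> (nat \<Rightarrow> 'a set) \<Rightarrow> bool" where
  "almost_direct G k F \<longleftrightarrow>
     iterated_semidirect G k F \<and>
     (\<forall>i\<in>{2..k}. \<forall>g\<in>stage G F (i - 1). \<forall>f\<in>F i.
        derived G (F i) #>\<^bsub>G\<^esub> (g \<otimes>\<^bsub>G\<^esub> f \<otimes>\<^bsub>G\<^esub> inv\<^bsub>G\<^esub> g) = derived G (F i) #>\<^bsub>G\<^esub> f)"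

section \<open>The lexicographic ordering and convexity\<close>

text \<open>The product \<open>c k \<cdots> c 1\<close>.\<close>

fun desc_prod :: "('a, 'b) monoid_scheme \<Rightarrow> (nat \<Rightarrow> 'a) \<Rightarrow> nat \<Rightarrow> 'a" where
  "desc_prod G c 0 = \<one>\<^bsub>G\<^esub>"
| "desc_prod G c (Suc k) = c (Suc k) \<otimes>\<^bsub>G\<^esub> desc_prod G c k"

definition lex_cone ::
  "('a, 'b) monoid_scheme \<Rightarrow> nat \<Rightarrow> (nat \<Rightarrow> 'a set) \<Rightarrow> (nat \<Rightarrow> 'a set) \<Rightarrow> 'a set" where
  "lex_cone G k F P = {g \<in> carrier G. \<exists>c. (\<forall>i\<in>{1..k}. c i \<in> F i) \<and> g = desc_prod G c k \<and>
     (\<exists>j\<in>{1..k}. c j \<in> P j \<and> (\<forall>i\<in>{j<..k}. c i = \<one>\<^bsub>G\<^esub>))}"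

definition cone_less :: "('a, 'b) monoid_scheme \<Rightarrow> 'a set \<Rightarrow> 'a \<Rightarrow> 'a \<Rightarrow> bool" where
  "cone_less G P g h \<longleftrightarrow>
     g \<in> carrier G \<and> h \<in> carrier G \<and> inv\<^bsub>G\<^esub> g \<otimes>\<^bsub>G\<^esub> h \<in> P"

definition convex_subgroup ::
  "('a, 'b) monoid_scheme \<Rightarrow> ('a \<Rightarrow> 'a \<Rightarrow> bool) \<Rightarrow> 'a set \<Rightarrow> bool" where
  "convex_subgroup G lt H \<longleftrightarrow> subgroup H G \<and>
     (\<forall>h1\<in>H. \<forall>h2\<in>H. \<forall>g\<in>carrier G. lt h1 g \<and> lt g h2 \<longrightarrow> g \<in> H)"

section \<open>Well-definedness of the Magnus embedding\<close>

lemma nc_series_simps: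
  "f \<in> carrier (nc_series n) \<longleftrightarrow> (\<forall>w. f w \<noteq> 0 \<longrightarrow> set w \<subseteq> {1..n})"
  "(f \<otimes>\<^bsub>nc_series n\<^esub> g) = (\<lambda>w. \<Sum>i\<le>length w. f (take i w) * g (drop i w))"
  "\<one>\<^bsub>nc_series n\<^esub> = (\<lambda>w. if w = [] then 1 else 0)"
  "\<zero>\<^bsub>nc_series n\<^esub> = (\<lambda>w. 0)"
  "(f \<oplus>\<^bsub>nc_series n\<^esub> g) = (\<lambda>w. f w + g w)"
  by (simp_all add: nc_series_def)

lemma nc_series_ring: "ring (nc_series n)"
proof (rule ringI)
  show "abelian_group (nc_series n)"
  proof (rule abelian_groupI)
    fix f assume "f \<in> carrier (nc_series n)"
    then show "\<exists>g\<in>carrier (nc_series n). g \<oplus>\<^bsub>nc_series n\<^esub> f = \<zero>\<^bsub>nc_series n\<^esub>"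
      by (intro bexI[of _ "\<lambda>w. - f w"]) (auto simp: nc_series_simps)
  next
    fix f g assume "f \<in> carrier (nc_series n)" "g \<in> carrier (nc_series n)"
    then show "f \<oplus>\<^bsub>nc_series n\<^esub> g \<in> carrier (nc_series n)"
      unfolding nc_series_simps by (metis add.right_neutral)
  qed (auto simp: nc_series_simps add_ac)
next
  show "monoid (nc_series n)"
  proof (rule monoidI)
    fix f g assume fg: "f \<in> carrier (nc_series n)" "g \<in> carrier (nc_series n)"
    have "set w \<subseteq> {1..n}" if nz: "(\<Sum>i\<le>length w. f (take i w) * g (drop i w)) \<noteq> 0" for w
    proof -
      obtain i where i: "f (take i w) \<noteq> 0" "g (drop i w) \<noteq> 0"
        using sum.not_neutral_contains_not_neutral[OF nz] by force
      have "set w = set (take i w) \<union> set (drop i w)"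
        by (metis append_take_drop_id set_append)
      then show ?thesis using i fg by (auto simp: nc_series_simps)
    qed
    then show "f \<otimes>\<^bsub>nc_series n\<^esub> g \<in> carrier (nc_series n)"
      by (simp add: nc_series_simps)
  next
    fix f g h :: "nat list \<Rightarrow> int"
    have "(\<Sum>i\<le>length w. (\<Sum>j\<le>length (take i w). f (take j (take i w)) * g (drop j (take i w))) * h (drop i w))
        = (\<Sum>i\<le>length w. f (take i w) * (\<Sum>j\<le>length (drop i w). g (take j (drop i w)) * h (drop j (drop i w))))"
      (is "?L = ?R") for w
    proof -
      have "?L = (\<Sum>i\<le>length w. \<Sum>j\<le>i. f (take j w) * g (drop j (take i w)) * h (drop i w))"
        by (intro sum.cong) (auto simp: sum_distrib_right min_def intro!: sum.cong)
      also have "\<dots> = (\<Sum>(i,j)\<in>Sigma {..length w} (\<lambda>i. {..i}).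
            f (take j w) * g (drop j (take i w)) * h (drop i w))"
        by (subst sum.Sigma) auto
      also have "\<dots> = (\<Sum>(i,j)\<in>Sigma {..length w} (\<lambda>i. {..length w - i}).
            f (take i w) * g (take j (drop i w)) * h (drop (j + i) w))"
        by (rule sum.reindex_bij_witness[where i = "\<lambda>(i,j). (i + j, i)" and j = "\<lambda>(i,j). (j, i - j)"])
          (auto simp: drop_take)
      also have "\<dots> = ?R"
        by (subst sum.Sigma[symmetric]) (auto simp: sum_distrib_left mult.assoc)
      finally show ?thesis .
    qed
    then show "f \<otimes>\<^bsub>nc_series n\<^esub> g \<otimes>\<^bsub>nc_series n\<^esub> h = f \<otimes>\<^bsub>nc_series n\<^esub> (g \<otimes>\<^bsub>nc_series n\<^esub> h)"
      by (simp add: nc_series_simps)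
  next
    fix f :: "nat list \<Rightarrow> int"
    have "(\<Sum>i\<le>length w. (if take i w = [] then 1 else 0) * f (drop i w)) = (\<Sum>i\<le>length w. if i = 0 then f w else 0)" for w
      by (intro sum.cong) auto
    then show "\<one>\<^bsub>nc_series n\<^esub> \<otimes>\<^bsub>nc_series n\<^esub> f = f"
      unfolding nc_series_simps by (simp add: fun_eq_iff)
    have "(\<Sum>i\<le>length w. f (take i w) * (if drop i w = [] then 1 else 0)) = (\<Sum>i\<le>length w. if i = length w then f w else 0)" for w
      by (intro sum.cong) auto
    then show "f \<otimes>\<^bsub>nc_series n\<^esub> \<one>\<^bsub>nc_series n\<^esub> = f"
      unfolding nc_series_simps by (simp add: fun_eq_iff)
  qed (simp add: nc_series_simps)
qed (simp_all add: nc_series_simps algebra_simps sum.distrib)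

lemma one_plus_var_unit:
  assumes "i \<in> {1..n}"
  shows "\<one>\<^bsub>nc_series n\<^esub> \<oplus>\<^bsub>nc_series n\<^esub> nc_var i \<in> Units (nc_series n)"
proof -
  define u where "u = \<one>\<^bsub>nc_series n\<^esub> \<oplus>\<^bsub>nc_series n\<^esub> nc_var i"
  define f :: "nat list \<Rightarrow> int" where
    "f = (\<lambda>w. if set w \<subseteq> {i} then (-1) ^ length w else 0)"
  have u: "u = (\<lambda>w. if w = [] then 1 else if w = [i] then 1 else 0)"
    by (auto simp: u_def nc_series_simps nc_var_def)
  have "(\<Sum>j\<le>length w. u (take j w) * f (drop j w)) = (if w = [] then 1 else 0)" for w
  proof (cases w)
    case (Cons a v)
    have "(\<Sum>j\<le>length w. u (take j w) * f (drop j w)) = (\<Sum>j\<in>{0,1}. u (take j w) * f (drop j w))"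
      by (rule sum.mono_neutral_right) (auto simp: Cons u take_Cons' split: if_splits)
    then show ?thesis by (simp add: Cons u f_def)
  qed (simp add: u f_def)
  then have 1: "u \<otimes>\<^bsub>nc_series n\<^esub> f = \<one>\<^bsub>nc_series n\<^esub>"
    by (simp add: nc_series_simps fun_eq_iff)
  have "(\<Sum>j\<le>length w. f (take j w) * u (drop j w)) = (if w = [] then 1 else 0)" for w
  proof (cases w rule: rev_cases)
    case (snoc v a)
    have "(\<Sum>j\<le>length w. f (take j w) * u (drop j w))
        = (\<Sum>j\<in>{length v, Suc (length v)}. f (take j w) * u (drop j w))"
    proof (rule sum.mono_neutral_right)
      show "\<forall>j\<in>{..length w} - {length v, Suc (length v)}. f (take j w) * u (drop j w) = 0"
      proof
        fix j assume "j \<in> {..length w} - {length v, Suc (length v)}"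
        then have "length (drop j w) \<ge> 2" by (auto simp: snoc)
        then have "drop j w \<noteq> []" "drop j w \<noteq> [i]" by (metis list.size(3) not_numeral_le_zero, force)
        then show "f (take j w) * u (drop j w) = 0" by (simp add: u)
      qed
    qed (auto simp: snoc)
    then show ?thesis by (simp add: snoc u f_def)
  qed (simp add: u f_def)
  then have 2: "f \<otimes>\<^bsub>nc_series n\<^esub> u = \<one>\<^bsub>nc_series n\<^esub>"
    by (simp add: nc_series_simps fun_eq_iff)
  have "u \<in> carrier (nc_series n)" "f \<in> carrier (nc_series n)"
    using assms by (auto simp: nc_series_simps u f_def split: if_splits)
  then show ?thesis
    using 1 2 unfolding u_def[symmetric] Units_def by blast
qed

lemma words_simps [simp]:
  "[] \<in> words n" "a # w \<in> words n \<longleftrightarrow> fst a \<in> {1..n} \<and> w \<in> words n"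
  "v @ w \<in> words n \<longleftrightarrow> v \<in> words n \<and> w \<in> words n"
  by (auto simp: words_def)

lemma letter_val_closed:
  assumes "group H" "x \<in> {1..n} \<rightarrow> carrier H" "fst a \<in> {1..n}"
  shows "letter_val H x a \<in> carrier H"
  using assms group.inv_closed by (fastforce simp: letter_val_def)

lemma word_val_closed:
  assumes "group H" "x \<in> {1..n} \<rightarrow> carrier H" "w \<in> words n"
  shows "word_val H x w \<in> carrier H"
  using assms(3)
proof (induction w)
  case (Cons a w)
  then show ?case
    using letter_val_closed[OF assms(1,2)] assms(1)
    by (simp add: word_val_def group.is_monoid monoid.m_closed)
qed (simp add: word_val_def assms(1) group.is_monoid monoid.one_closed)

lemma word_val_append:
  assumes "group H" "x \<in> {1..n} \<rightarrow> carrier H" "v \<in> words n" "w \<in> words n"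
  shows "word_val H x (v @ w) = word_val H x v \<otimes>\<^bsub>H\<^esub> word_val H x w"
  using assms(3)
proof (induction v)
  case Nil
  then show ?case
    using word_val_closed[OF assms(1,2,4)] assms(1)
    by (simp add: word_val_def group.is_monoid monoid.l_one)
next
  case (Cons a v)
  interpret group H by fact
  have "letter_val H x a \<in> carrier H" "word_val H x v \<in> carrier H" "word_val H x w \<in> carrier H"
    using Cons.prems letter_val_closed[OF assms(1,2)] word_val_closed[OF assms(1,2)] assms(4) by auto
  moreover have "word_val H x (b # u) = letter_val H x b \<otimes>\<^bsub>H\<^esub> word_val H x u" for b u
    by (simp add: word_val_def)
  ultimately show ?case using Cons by (simp add: m_assoc)
qed

definition inv_word :: "word \<Rightarrow> word" where
  "inv_word w = rev (map (\<lambda>(i, e). (i, \<not> e)) w)"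

lemma inv_word_words: "w \<in> words n \<Longrightarrow> inv_word w \<in> words n"
  by (auto simp: inv_word_def words_def image_subset_iff)

lemma word_val_single:
  assumes "group H" "x \<in> {1..n} \<rightarrow> carrier H" "fst a \<in> {1..n}"
  shows "word_val H x [a] = letter_val H x a"
  using letter_val_closed[OF assms] assms(1)
  by (simp add: word_val_def group.is_monoid monoid.r_one)

lemma word_val_cancel:
  assumes "group H" "x \<in> {1..n} \<rightarrow> carrier H" "i \<in> {1..n}"
  shows "word_val H x [(i, e), (i, \<not> e)] = \<one>\<^bsub>H\<^esub>"
proof -
  interpret group H by fact
  have "x i \<in> carrier H" using assms by auto
  then show ?thesis by (cases e) (simp_all add: word_val_def letter_val_def)
qed

lemma word_val_inv_word:
  assumes "group H" "x \<in> {1..n} \<rightarrow> carrier H" "w \<in> words n"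
  shows "word_val H x w \<otimes>\<^bsub>H\<^esub> word_val H x (inv_word w) = \<one>\<^bsub>H\<^esub>"
  using assms(3)
proof (induction w)
  case Nil
  then show ?case using assms(1) by (simp add: word_val_def inv_word_def group.is_monoid)
next
  case (Cons a w)
  interpret group H by fact
  obtain i e where a: "a = (i, e)" by force
  have iw: "i \<in> {1..n}" "w \<in> words n" using Cons.prems a by auto
  have inv: "inv_word (a # w) = inv_word w @ [(i, \<not> e)]"
    by (simp add: inv_word_def a)
  note app = word_val_append[OF assms(1,2)] and cl = word_val_closed[OF assms(1,2)]
  have c: "word_val H x [(i, b)] \<in> carrier H" for b
    by (rule cl) (use iw in simp)
  have "word_val H x (a # w) = word_val H x [(i, e)] \<otimes>\<^bsub>H\<^esub> word_val H x w"
    using app[of "[(i, e)]" w] iw a by simp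
  moreover have "word_val H x (inv_word (a # w))
      = word_val H x (inv_word w) \<otimes>\<^bsub>H\<^esub> word_val H x [(i, \<not> e)]"
    unfolding inv using iw by (intro app) (simp_all add: inv_word_words)
  moreover have "word_val H x [(i, e)] \<otimes>\<^bsub>H\<^esub> word_val H x [(i, \<not> e)] = \<one>\<^bsub>H\<^esub>"
    using app[of "[(i, e)]" "[(i, \<not> e)]"] word_val_cancel[OF assms(1,2) iw(1), of e] iw by simp
  moreover have "word_val H x w \<otimes>\<^bsub>H\<^esub> (word_val H x (inv_word w) \<otimes>\<^bsub>H\<^esub> word_val H x [(i, \<not> e)])
      = word_val H x [(i, \<not> e)]"
    using Cons.IH[OF iw(2)] c cl iw inv_word_words by (metis m_assoc l_one)
  ultimately show ?case
    using c cl iw inv_word_words by (simp add: m_assoc)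
qed

lemma not_reduced_split:
  assumes "\<not> reduced w"
  obtains u v i e where "w = u @ [(i, e), (i, \<not> e)] @ v"
proof -
  obtain j where j: "Suc j < length w" "fst (w ! j) = fst (w ! Suc j)" "snd (w ! j) \<noteq> snd (w ! Suc j)"
    using assms unfolding reduced_def successively_conv_nth by blast
  have "w = take j w @ [w ! j, w ! Suc j] @ drop (Suc (Suc j)) w"
    using j(1) by (simp add: Cons_nth_drop_Suc Suc_lessD)
  moreover have "w ! j = (fst (w ! j), snd (w ! j))" "w ! Suc j = (fst (w ! j), \<not> snd (w ! j))"
    using j by (auto simp: prod_eq_iff)
  ultimately show ?thesis using that by metis
qed

lemma word_val_delete:
  assumes "group H" "x \<in> {1..n} \<rightarrow> carrier H" "u \<in> words n" "v \<in> words n" "i \<in> {1..n}"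
  shows "word_val H x (u @ [(i, e), (i, \<not> e)] @ v) = word_val H x (u @ v)"
proof -
  interpret group H by fact
  have m: "[(i, e), (i, \<not> e)] \<in> words n" using assms by simp
  then have m': "[(i, e), (i, \<not> e)] @ v \<in> words n" using assms by simp
  show ?thesis
    using word_val_append[OF assms(1,2,3) m'] word_val_append[OF assms(1,2) m assms(4)]
      word_val_append[OF assms(1,2,3,4)] word_val_cancel[OF assms(1,2,5), of e]
      word_val_closed[OF assms(1,2,4)]
    by simp
qed

lemma free_basis_relation:
  assumes "group H" "free_basis H n x" "group K" "y \<in> {1..n} \<rightarrow> carrier K"
    and "w \<in> words n" "word_val H x w = \<one>\<^bsub>H\<^esub>"
  shows "word_val K y w = \<one>\<^bsub>K\<^esub>"
  using assms(5,6)
proof (induction w rule: length_induct)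
  case (1 w)
  have x: "x \<in> {1..n} \<rightarrow> carrier H" using assms(2) by (simp add: free_basis_def)
  show ?case
  proof (cases "w = []")
    case False
    then have "\<not> reduced w" using 1 assms(2) by (auto simp: free_basis_def)
    then obtain u v i e where w: "w = u @ [(i, e), (i, \<not> e)] @ v" by (rule not_reduced_split)
    have uv: "u \<in> words n" "v \<in> words n" "i \<in> {1..n}" using 1(2) w by auto
    note del = word_val_delete[OF _ _ uv, of _ _ e, folded w]
    have "word_val H x (u @ v) = \<one>\<^bsub>H\<^esub>" using del[OF assms(1) x] 1 by simp
    then have "word_val K y (u @ v) = \<one>\<^bsub>K\<^esub>" using 1(1) uv w by simp
    then show ?thesis using del[OF assms(3,4)] by simp
  qed (simp add: word_val_def)
qed

lemma free_basis_word:
  assumes "group H" "free_basis H n x" "g \<in> carrier H"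
  obtains w where "w \<in> words n" "word_val H x w = g"
proof -
  have x: "x \<in> {1..n} \<rightarrow> carrier H" using assms(2) by (simp add: free_basis_def)
  have "g \<in> generate H (x ` {1..n})" using assms by (simp add: free_basis_def)
  then have "\<exists>w\<in>words n. word_val H x w = g"
  proof (induction rule: generate.induct)
    case one
    then show ?case by (intro bexI[of _ "[]"]) (simp_all add: word_val_def)
  next
    case (incl h)
    then obtain i where "i \<in> {1..n}" "h = x i" by auto
    then show ?case
      by (intro bexI[of _ "[(i, True)]"])
        (simp_all add: word_val_single[OF assms(1) x] letter_val_def)
  next
    case (inv h)
    then obtain i where "i \<in> {1..n}" "h = x i" by auto
    then show ?case
      by (intro bexI[of _ "[(i, False)]"])
        (simp_all add: word_val_single[OF assms(1) x] letter_val_def)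
  next
    case (eng h1 h2)
    then obtain w1 w2 where "w1 \<in> words n" "word_val H x w1 = h1" "w2 \<in> words n" "word_val H x w2 = h2"
      by auto
    then show ?case
      by (intro bexI[of _ "w1 @ w2"]) (simp_all add: word_val_append[OF assms(1) x])
  qed
  then show ?thesis using that by auto
qed

lemma hom_word_val:
  assumes "group H" "x \<in> {1..n} \<rightarrow> carrier H" "group K" "y \<in> {1..n} \<rightarrow> carrier K"
    and "h \<in> hom H K" "\<forall>i\<in>{1..n}. h (x i) = y i" "w \<in> words n"
  shows "h (word_val H x w) = word_val K y w"
proof -
  interpret group_hom H K h
    using assms by (simp add: group_hom_def group_hom_axioms_def)
  show ?thesis using assms(7)
  proof (induction w)
    case (Cons a w)
    have "h (letter_val H x a) = letter_val K y a"
      using Cons.prems assms(2,6) by (auto simp: letter_val_def Pi_iff)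
    moreover have "letter_val H x a \<in> carrier H" "word_val H x w \<in> carrier H"
      using Cons.prems letter_val_closed[OF assms(1,2)] word_val_closed[OF assms(1,2)] by auto
    ultimately show ?case using Cons by (simp add: word_val_def)
  qed (simp add: word_val_def)
qed

theorem free_basis_extension:
  assumes H: "group H" and fb: "free_basis H n x"
    and K: "group K" and y: "y \<in> {1..n} \<rightarrow> carrier K"
  shows "\<exists>!h. h \<in> hom H K \<and> h \<in> extensional (carrier H) \<and> (\<forall>i\<in>{1..n}. h (x i) = y i)"
proof -
  interpret H: group H by fact
  interpret K: group K by fact
  have x: "x \<in> {1..n} \<rightarrow> carrier H" using fb by (simp add: free_basis_def)
  define rep where "rep g = (SOME w. w \<in> words n \<and> word_val H x w = g)" for g
  have rep: "rep g \<in> words n" "word_val H x (rep g) = g" if "g \<in> carrier H" for g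
    using someI_ex[of "\<lambda>w. w \<in> words n \<and> word_val H x w = g"] free_basis_word[OF H fb that]
    unfolding rep_def by metis+
  have wd: "word_val K y v = word_val K y w"
    if vw: "v \<in> words n" "w \<in> words n" "word_val H x v = word_val H x w" for v w
  proof -
    have "word_val H x (v @ inv_word w) = \<one>\<^bsub>H\<^esub>"
      using vw word_val_append[OF H x] word_val_inv_word[OF H x] inv_word_words by metis
    then have "word_val K y (v @ inv_word w) = \<one>\<^bsub>K\<^esub>"
      using vw inv_word_words by (intro free_basis_relation[OF H fb K y]) auto
    then have "word_val K y v \<otimes>\<^bsub>K\<^esub> word_val K y (inv_word w)
        = word_val K y w \<otimes>\<^bsub>K\<^esub> word_val K y (inv_word w)"
      using vw word_val_append[OF K y] word_val_inv_word[OF K y] inv_word_words by metis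
    then show ?thesis
      using vw word_val_closed[OF K y] inv_word_words by (simp add: K.r_cancel)
  qed
  define h where "h = restrict (\<lambda>g. word_val K y (rep g)) (carrier H)"
  have hw: "h (word_val H x w) = word_val K y w" if "w \<in> words n" for w
  proof -
    have c: "word_val H x w \<in> carrier H" using that by (rule word_val_closed[OF H x])
    have "word_val K y (rep (word_val H x w)) = word_val K y w"
      by (rule wd[OF rep(1)[OF c] that rep(2)[OF c]])
    then show ?thesis using c by (simp add: h_def)
  qed
  show ?thesis
  proof (rule ex1I[of _ h], intro conjI ballI)
    show "h \<in> hom H K"
    proof (rule homI)
      fix g assume "g \<in> carrier H"
      then show "h g \<in> carrier K" using rep word_val_closed[OF K y] by (simp add: h_def)
    next
      fix g g' assume "g \<in> carrier H" "g' \<in> carrier H"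
      then obtain w w' where "w \<in> words n" "word_val H x w = g" "w' \<in> words n" "word_val H x w' = g'"
        using rep by metis
      then show "h (g \<otimes>\<^bsub>H\<^esub> g') = h g \<otimes>\<^bsub>K\<^esub> h g'"
        using hw[of w] hw[of w'] hw[of "w @ w'"] word_val_append[OF H x] word_val_append[OF K y] by simp
    qed
    show "h \<in> extensional (carrier H)" by (simp add: h_def)
    fix i assume "i \<in> {1..n}"
    then show "h (x i) = y i"
      using hw[of "[(i, True)]"] word_val_single[OF H x] word_val_single[OF K y]
      by (simp add: letter_val_def)
  next
    fix h' assume h': "h' \<in> hom H K \<and> h' \<in> extensional (carrier H) \<and> (\<forall>i\<in>{1..n}. h' (x i) = y i)"
    show "h' = h"
    proof (rule extensionalityI[of _ "carrier H"])
      fix g assume "g \<in> carrier H"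
      then show "h' g = h g"
        using rep[of g] hom_word_val[OF H x K y, of h'] h' hw by metis
    qed (use h' in \<open>simp_all add: h_def\<close>)
  qed
qed

corollary magnus_unique_existence:
  assumes "group H" "free_basis H n x"
  shows "\<exists>!\<mu>. \<mu> \<in> hom H (units_of (nc_series n)) \<and> \<mu> \<in> extensional (carrier H) \<and>
     (\<forall>i\<in>{1..n}. \<mu> (x i) = \<one>\<^bsub>nc_series n\<^esub> \<oplus>\<^bsub>nc_series n\<^esub> nc_var i)"
proof (rule free_basis_extension[OF assms])
  interpret ring "nc_series n" by (rule nc_series_ring)
  show "group (units_of (nc_series n))" by (rule units_group)
  show "(\<lambda>i. \<one>\<^bsub>nc_series n\<^esub> \<oplus>\<^bsub>nc_series n\<^esub> nc_var i) \<in> {1..n} \<rightarrow> carrier (units_of (nc_series n))"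
    using one_plus_var_unit by (auto simp: units_of_carrier)
qed

end

theory Submission
  imports Defs
begin

text \<open>Conjugation by an element of a lower stage induces an endomorphism \<open>\<phi>\<close> of the free factor
  that is trivial on the abelianization. The Magnus expansion turns \<open>\<phi>\<close> into a substitution
  \<open>X i \<mapsto> X i + (terms of degree at least 2)\<close>, which fixes the lowest homogeneous part of every
  series, so the Magnus cone is invariant under \<open>\<phi>\<close>. If \<open>h1 < g < h2\<close> with \<open>h1\<close>, \<open>h2\<close> in stage
  \<open>j\<close> while the top nontrivial factor \<open>c\<close> of \<open>g\<close> lies above stage \<open>j\<close>, then the top factors of
  \<open>inv h1 g\<close> and \<open>inv g h2\<close> are conjugates of \<open>c\<close> and of \<open>inv c\<close> by elements of lower stages.
  Hence both \<open>c\<close> and its inverse would be positive.\<close>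

section \<open>Substitution into power series\<close>

text \<open>Image of the monomial \<open>w\<close> under the substitution that sends the i-th
  variable to \<open>Y i\<close>.\<close>

definition nc_word_prod :: "nat \<Rightarrow> (nat \<Rightarrow> nat list \<Rightarrow> int) \<Rightarrow> nat list \<Rightarrow> nat list \<Rightarrow> int" where
  "nc_word_prod n Y w = foldr (\<lambda>i f. Y i \<otimes>\<^bsub>nc_series n\<^esub> f) w \<one>\<^bsub>nc_series n\<^esub>"

text \<open>The bound \<open>length w \<le> length v\<close> keeps the sum finite; it discards only vanishing terms
  when the series \<open>Y i\<close> have no constant term.\<close>

definition nc_subst ::
  "nat \<Rightarrow> (nat \<Rightarrow> nat list \<Rightarrow> int) \<Rightarrow> (nat list \<Rightarrow> int) \<Rightarrow> nat list \<Rightarrow> int" where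
  "nc_subst n Y f v =
     (\<Sum>w | set w \<subseteq> {1..n} \<and> length w \<le> length v. f w * nc_word_prod n Y w v)"

lemma nc_mult_Nil: "(f \<otimes>\<^bsub>nc_series n\<^esub> g) [] = f [] * g []"
  by (simp add: nc_series_simps)

lemma nc_mult_single: "(f \<otimes>\<^bsub>nc_series n\<^esub> g) [i] = f [] * g [i] + f [i] * g []"
  by (simp add: nc_series_simps)

lemma nc_word_prod_simps:
  "nc_word_prod n Y [] = \<one>\<^bsub>nc_series n\<^esub>"
  "nc_word_prod n Y (i # w) = Y i \<otimes>\<^bsub>nc_series n\<^esub> nc_word_prod n Y w"
  by (simp_all add: nc_word_prod_def)

lemma nc_word_prod_closed:
  assumes "Y \<in> {1..n} \<rightarrow> carrier (nc_series n)" "set w \<subseteq> {1..n}"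
  shows "nc_word_prod n Y w \<in> carrier (nc_series n)"
proof -
  interpret ring "nc_series n" by (rule nc_series_ring)
  show ?thesis using assms(2)
    by (induction w) (use assms(1) in \<open>auto simp: nc_word_prod_simps\<close>)
qed

lemma nc_word_prod_append:
  assumes Y: "Y \<in> {1..n} \<rightarrow> carrier (nc_series n)" and "set u \<subseteq> {1..n}" and w: "set w \<subseteq> {1..n}"
  shows "nc_word_prod n Y (u @ w) = nc_word_prod n Y u \<otimes>\<^bsub>nc_series n\<^esub> nc_word_prod n Y w"
proof -
  interpret ring "nc_series n" by (rule nc_series_ring)
  show ?thesis using assms(2)
  proof (induction u)
    case (Cons i u)
    then have "Y i \<in> carrier (nc_series n)" using Y by auto
    then show ?case
      using Cons nc_word_prod_closed[OF Y] w by (simp add: nc_word_prod_simps m_assoc)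
  qed (simp add: nc_word_prod_simps nc_word_prod_closed[OF Y w])
qed

text \<open>A product of series without constant term has order at least the number of its
  factors.\<close>

lemma nc_word_prod_eq_0:
  assumes "\<And>i. i \<in> {1..n} \<Longrightarrow> Y i [] = 0" "set w \<subseteq> {1..n}" "length v < length w"
  shows "nc_word_prod n Y w v = 0"
  using assms(2,3)
proof (induction w arbitrary: v)
  case (Cons i w)
  have "Y i (take j v) * nc_word_prod n Y w (drop j v) = 0" if "j \<le> length v" for j
  proof (cases "j = 0")
    case False
    then have "nc_word_prod n Y w (drop j v) = 0" using Cons.prems that by (intro Cons.IH) auto
    then show ?thesis by simp
  qed (use Cons.prems assms(1) in simp)
  then show ?case unfolding nc_word_prod_simps nc_series_simps by (intro sum.neutral) blast
qed simp

text \<open>In the lowest possible degree each factor can contribute only its linear part, and the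
  linear part of \<open>Y i\<close> is the variable itself.\<close>

lemma nc_word_prod_same_length:
  assumes "\<And>i. i \<in> {1..n} \<Longrightarrow> Y i [] = 0"
    and "\<And>i j. i \<in> {1..n} \<Longrightarrow> Y i [j] = (if i = j then 1 else 0)"
    and "set w \<subseteq> {1..n}" "length v = length w"
  shows "nc_word_prod n Y w v = (if v = w then 1 else 0)"
  using assms(3,4)
proof (induction w arbitrary: v)
  case (Cons i w)
  then obtain b v' where v: "v = b # v'" "length v' = length w" by (metis length_Suc_conv)
  \<comment> \<open>Only the split after one letter survives: the empty prefix meets the missing
    constant term, and a longer prefix leaves a suffix shorter than \<open>w\<close>.\<close>
  have "Y i (take j v) * nc_word_prod n Y w (drop j v) = 0" if "j \<le> length v" "j \<noteq> 1" for j
  proof (cases "j = 0")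
    case False
    then have "nc_word_prod n Y w (drop j v) = 0"
      using Cons.prems that by (intro nc_word_prod_eq_0) (auto simp: assms(1))
    then show ?thesis by simp
  qed (use Cons.prems assms(1) in simp)
  then have "nc_word_prod n Y (i # w) v
      = (\<Sum>j\<in>{1}. Y i (take j v) * nc_word_prod n Y w (drop j v))"
    unfolding nc_word_prod_simps nc_series_simps
    by (intro sum.mono_neutral_right) (auto simp: v)
  also have "\<dots> = (if v = i # w then 1 else 0)"
    using Cons.IH[of v'] Cons.prems v assms(2)[of i b] by auto
  finally show ?case .
qed (simp add: nc_word_prod_simps nc_series_simps)

text \<open>The additional words are longer than \<open>v\<close>, so their products have no term at
  \<open>v\<close>. The free bound \<open>N\<close> lets all prefixes and suffixes of one monomial
  share an index set.\<close>

lemma nc_subst_extend: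
  assumes "\<And>i. i \<in> {1..n} \<Longrightarrow> Y i [] = 0" "length v \<le> N"
  shows "nc_subst n Y f v
    = (\<Sum>w | set w \<subseteq> {1..n} \<and> length w \<le> N. f w * nc_word_prod n Y w v)"
  unfolding nc_subst_def
  by (rule sum.mono_neutral_left)
    (use assms nc_word_prod_eq_0 in \<open>auto simp: finite_lists_length_le not_le\<close>)

lemma nc_subst_one: "nc_subst n Y \<one>\<^bsub>nc_series n\<^esub> = \<one>\<^bsub>nc_series n\<^esub>"
proof
  fix v :: "nat list"
  have "nc_subst n Y \<one>\<^bsub>nc_series n\<^esub> v
      = (\<Sum>w\<in>{[]}. \<one>\<^bsub>nc_series n\<^esub> w * nc_word_prod n Y w v)"
    unfolding nc_subst_def
    by (rule sum.mono_neutral_right) (auto simp: finite_lists_length_le nc_series_simps)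
  then show "nc_subst n Y \<one>\<^bsub>nc_series n\<^esub> v = \<one>\<^bsub>nc_series n\<^esub> v"
    by (simp add: nc_word_prod_simps nc_series_simps)
qed

lemma nc_subst_add:
  "nc_subst n Y (f \<oplus>\<^bsub>nc_series n\<^esub> g) = nc_subst n Y f \<oplus>\<^bsub>nc_series n\<^esub> nc_subst n Y g"
  by (simp add: fun_eq_iff nc_series_simps nc_subst_def distrib_right sum.distrib)

lemma nc_subst_var:
  assumes "i \<in> {1..n}" "Y i \<in> carrier (nc_series n)" "Y i [] = 0"
  shows "nc_subst n Y (nc_var i) = Y i"
proof
  fix v
  interpret ring "nc_series n" by (rule nc_series_ring)
  \<comment> \<open>For empty \<open>v\<close> the length bound already excludes the word
    \<open>[i]\<close>; the empty sum then agrees with \<open>Y i []\<close>, which is 0.\<close>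
  have "nc_subst n Y (nc_var i) v
      = (\<Sum>w\<in>(if v = [] then {} else {[i]}). nc_var i w * nc_word_prod n Y w v)"
    unfolding nc_subst_def
    by (rule sum.mono_neutral_right)
      (use assms(1) in \<open>auto simp: finite_lists_length_le nc_var_def Suc_le_eq\<close>)
  then show "nc_subst n Y (nc_var i) v = Y i v"
    using assms by (auto simp: nc_word_prod_simps nc_var_def)
qed

text \<open>Both sides expand into the same sum over pairs of words \<open>a\<close>,
  \<open>b\<close>, since the product belonging to \<open>a @ b\<close> factors.\<close>

lemma nc_subst_mult:
  assumes Y: "Y \<in> {1..n} \<rightarrow> carrier (nc_series n)" and Y0: "\<And>i. i \<in> {1..n} \<Longrightarrow> Y i [] = 0"
  shows "nc_subst n Y (f \<otimes>\<^bsub>nc_series n\<^esub> g) = nc_subst n Y f \<otimes>\<^bsub>nc_series n\<^esub> nc_subst n Y g"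
proof
  fix v :: "nat list"
  let ?M = "nc_word_prod n Y"
  define S where "S = {w. set w \<subseteq> {1..n} \<and> length w \<le> length v}"
  have fin: "finite S" by (simp add: S_def finite_lists_length_le)
  have "nc_subst n Y (f \<otimes>\<^bsub>nc_series n\<^esub> g) v
      = (\<Sum>w\<in>S. \<Sum>j\<le>length w. f (take j w) * g (drop j w) * ?M w v)"
    by (simp add: nc_subst_def S_def nc_series_simps sum_distrib_right)
  also have "\<dots> = (\<Sum>(w,j)\<in>Sigma S (\<lambda>w. {..length w}). f (take j w) * g (drop j w) * ?M w v)"
    by (rule sum.Sigma) (auto simp: fin)
  \<comment> \<open>A word with a cut position is the same data as the pair of its two
    pieces.\<close>
  also have "\<dots> = (\<Sum>(a,b)\<in>{p \<in> S \<times> S. length (fst p) + length (snd p) \<le> length v}.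
      f a * g b * ?M (a @ b) v)"
    by (rule sum.reindex_bij_witness[where i = "\<lambda>(a,b). (a @ b, length a)"
          and j = "\<lambda>(w,j). (take j w, drop j w)"])
      (force simp: S_def dest: in_set_takeD in_set_dropD)+
  \<comment> \<open>The pairs added here have total length above \<open>length v\<close>, so their
    products have too high an order to reach \<open>v\<close>.\<close>
  also have "\<dots> = (\<Sum>(a,b)\<in>S \<times> S. f a * g b * ?M (a @ b) v)"
  proof (rule sum.mono_neutral_left)
    show "\<forall>p\<in>S \<times> S - {p \<in> S \<times> S. length (fst p) + length (snd p) \<le> length v}.
        (case p of (a, b) \<Rightarrow> f a * g b * ?M (a @ b) v) = 0"
      by (fastforce simp: S_def intro!: nc_word_prod_eq_0 Y0)
  qed (auto simp: fin)
  also have "\<dots> = (\<Sum>a\<in>S. \<Sum>b\<in>S. \<Sum>i\<le>length v. f a * ?M a (take i v) * (g b * ?M b (drop i v)))"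
    unfolding sum.cartesian_product[symmetric]
    by (intro sum.cong)
      (auto simp: S_def nc_word_prod_append[OF Y] nc_series_simps sum_distrib_left mult_ac)
  also have "\<dots> = (\<Sum>i\<le>length v. \<Sum>a\<in>S. \<Sum>b\<in>S. f a * ?M a (take i v) * (g b * ?M b (drop i v)))"
    by (simp only: sum.swap[of _ "{..length v}" S])
  also have "\<dots> = (\<Sum>i\<le>length v. nc_subst n Y f (take i v) * nc_subst n Y g (drop i v))"
  proof (rule sum.cong)
    fix i assume "i \<in> {..length v}"
    then have "length (take i v) \<le> length v" "length (drop i v) \<le> length v" by auto
    then show "(\<Sum>a\<in>S. \<Sum>b\<in>S. f a * ?M a (take i v) * (g b * ?M b (drop i v)))
        = nc_subst n Y f (take i v) * nc_subst n Y g (drop i v)"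
      by (simp only: nc_subst_extend[of n Y _ "length v", OF Y0] S_def sum_product)
  qed simp
  finally show "nc_subst n Y (f \<otimes>\<^bsub>nc_series n\<^esub> g) v
      = (nc_subst n Y f \<otimes>\<^bsub>nc_series n\<^esub> nc_subst n Y g) v"
    by (simp add: nc_series_simps)
qed

lemma nc_subst_closed:
  assumes "Y \<in> {1..n} \<rightarrow> carrier (nc_series n)"
  shows "nc_subst n Y f \<in> carrier (nc_series n)"
proof -
  have "set v \<subseteq> {1..n}" if nz: "nc_subst n Y f v \<noteq> 0" for v
  proof -
    obtain w where "set w \<subseteq> {1..n}" "nc_word_prod n Y w v \<noteq> 0"
      using sum.not_neutral_contains_not_neutral[OF nz[unfolded nc_subst_def]] by force
    then show ?thesis using nc_word_prod_closed[OF assms] by (simp add: nc_series_simps)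
  qed
  then show ?thesis by (simp add: nc_series_simps)
qed

text \<open>Multiplicativity carries two-sided inverses along. This makes substitution composable
  with the Magnus map as a group homomorphism.\<close>

lemma nc_subst_hom_units:
  assumes Y: "Y \<in> {1..n} \<rightarrow> carrier (nc_series n)" and Y0: "\<And>i. i \<in> {1..n} \<Longrightarrow> Y i [] = 0"
  shows "nc_subst n Y \<in> hom (units_of (nc_series n)) (units_of (nc_series n))"
proof (rule homI)
  interpret ring "nc_series n" by (rule nc_series_ring)
  fix f assume "f \<in> carrier (units_of (nc_series n))"
  then obtain g where "g \<otimes>\<^bsub>nc_series n\<^esub> f = \<one>\<^bsub>nc_series n\<^esub>" "f \<otimes>\<^bsub>nc_series n\<^esub> g = \<one>\<^bsub>nc_series n\<^esub>"
    by (auto simp: units_of_carrier Units_def)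
  then have "nc_subst n Y g \<otimes>\<^bsub>nc_series n\<^esub> nc_subst n Y f = \<one>\<^bsub>nc_series n\<^esub>"
    "nc_subst n Y f \<otimes>\<^bsub>nc_series n\<^esub> nc_subst n Y g = \<one>\<^bsub>nc_series n\<^esub>"
    by (metis nc_subst_mult[OF Y Y0] nc_subst_one)+
  then show "nc_subst n Y f \<in> carrier (units_of (nc_series n))"
    using nc_subst_closed[OF Y] by (auto simp: units_of_carrier Units_def)
qed (simp add: units_of_mult, rule nc_subst_mult[OF Y Y0])

text \<open>Each variable is replaced by itself plus terms of degree at least 2, so a change can
  occur only above the lowest degree of \<open>f\<close>.\<close>

lemma nc_subst_lowest:
  assumes Y0: "\<And>i. i \<in> {1..n} \<Longrightarrow> Y i [] = 0"
    and Y1: "\<And>i j. i \<in> {1..n} \<Longrightarrow> Y i [j] = (if i = j then 1 else 0)"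
    and f: "f \<in> carrier (nc_series n)" "\<And>w. length w < length v \<Longrightarrow> f w = 0"
  shows "nc_subst n Y f v = f v"
proof -
  \<comment> \<open>Words of the same length as \<open>v\<close> reproduce only themselves; shorter
    words have coefficient 0 in \<open>f\<close>.\<close>
  have z: "f w * nc_word_prod n Y w v = 0"
    if "set w \<subseteq> {1..n}" "length w \<le> length v" "w \<noteq> v" for w
  proof (cases "length w = length v")
    case True
    then show ?thesis using that nc_word_prod_same_length[OF Y0 Y1, where w = w and v = v] by simp
  qed (use that f(2) in simp)
  show ?thesis
  proof (cases "set v \<subseteq> {1..n}")
    case True
    have "nc_subst n Y f v = (\<Sum>w\<in>{v}. f w * nc_word_prod n Y w v)"
      unfolding nc_subst_def
      by (rule sum.mono_neutral_right) (use z True in \<open>auto simp: finite_lists_length_le\<close>)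
    then show ?thesis using nc_word_prod_same_length[OF Y0 Y1 True] by simp
  next
    case False
    \<comment> \<open>Here \<open>v\<close> is not among the summation words, and \<open>f v\<close>
      is 0 because \<open>f\<close> involves only the first \<open>n\<close> variables.\<close>
    then have "nc_subst n Y f v = 0"
      unfolding nc_subst_def using z by (intro sum.neutral) auto
    then show ?thesis using False f(1) by (auto simp: nc_series_simps)
  qed
qed

section \<open>Invariance of the Magnus cone\<close>

text \<open>The sign condition inside \<open>magnus_cone\<close>, detached from the group so that
  substitutions can be applied to it.\<close>

definition nc_lowest_pos :: "(nat list \<Rightarrow> int) \<Rightarrow> bool" where
  "nc_lowest_pos f \<longleftrightarrow> (\<exists>w. f w > 0 \<and> (\<forall>v. (v, w) \<in> lenlex less_than \<longrightarrow> f v = 0))"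

text \<open>Everything shorter than the lowest monomial \<open>w\<close> of \<open>f\<close> has
  coefficient 0, so all coefficients up to degree \<open>length w\<close> are preserved and
  \<open>w\<close> remains the witness.\<close>

lemma nc_lowest_pos_subst:
  assumes "\<And>i. i \<in> {1..n} \<Longrightarrow> Y i [] = 0"
    and "\<And>i j. i \<in> {1..n} \<Longrightarrow> Y i [j] = (if i = j then 1 else 0)"
    and f: "f \<in> carrier (nc_series n)" and "nc_lowest_pos f"
  shows "nc_lowest_pos (nc_subst n Y f)"
proof -
  obtain w where w: "f w > 0" "\<And>v. (v, w) \<in> lenlex less_than \<Longrightarrow> f v = 0"
    using assms(4) by (auto simp: nc_lowest_pos_def)
  have "nc_subst n Y f v = f v" if "length v \<le> length w" for v
    using that by (intro nc_subst_lowest assms(1,2) f w(2)) (auto simp: lenlex_conv)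
  then show ?thesis
    using w lenlex_length[of _ w less_than] by (auto simp: nc_lowest_pos_def intro!: exI[of _ w])
qed

text \<open>Writing f = 1 + a and g = 1 + b, the equation fg = 1 reads a + b + ab = 0. At the lowest
  monomial of a the term ab vanishes, so b has the opposite coefficient there.\<close>

lemma nc_lowest_pos_not_inverse:
  assumes inv: "f \<otimes>\<^bsub>nc_series n\<^esub> g = \<one>\<^bsub>nc_series n\<^esub>"
      "g \<otimes>\<^bsub>nc_series n\<^esub> f = \<one>\<^bsub>nc_series n\<^esub>"
    and Nil: "f [] = 1" "g [] = 1"
    and pos: "nc_lowest_pos (\<lambda>w. f w - \<one>\<^bsub>nc_series n\<^esub> w)"
  shows "\<not> nc_lowest_pos (\<lambda>w. g w - \<one>\<^bsub>nc_series n\<^esub> w)"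
proof
  let ?e = "\<one>\<^bsub>nc_series n\<^esub>"
  \<comment> \<open>The case where the lowest monomial of \<open>f\<close> minus 1 does not exceed
    that of \<open>g\<close> minus 1; exchanging \<open>f\<close> and \<open>g\<close> gives the
    other case, using the other product.\<close>
  have no: False
    if eq: "f \<otimes>\<^bsub>nc_series n\<^esub> g = ?e" and Nil: "f [] = 1" "g [] = 1"
      and w: "f w - ?e w > 0" "\<And>v. (v, w) \<in> lenlex less_than \<Longrightarrow> f v - ?e v = 0"
      and w': "g w' - ?e w' > 0" "\<And>v. (v, w') \<in> lenlex less_than \<Longrightarrow> g v - ?e v = 0"
      and le: "(w, w') \<in> lenlex less_than \<or> w = w'"
    for f g :: "nat list \<Rightarrow> int" and w w'
  proof -
    have ne: "w \<noteq> []" using w(1) Nil by (auto simp: nc_series_simps)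
    \<comment> \<open>A proper prefix of \<open>w\<close> has smaller degree, hence precedes
      \<open>w\<close>, and a nonempty one carries no contribution from the constant 1.\<close>
    have z: "f (take i w) * g (drop i w) = 0" if "i \<le> length w" "i \<noteq> 0" "i \<noteq> length w" for i
    proof -
      have "f (take i w) - ?e (take i w) = 0" using that by (intro w(2)) (auto simp: lenlex_conv)
      moreover have "?e (take i w) = 0" using that ne by (simp add: nc_series_simps)
      ultimately show ?thesis by simp
    qed
    have "0 = (\<Sum>i\<le>length w. f (take i w) * g (drop i w))"
      using fun_cong[OF eq, of w] ne by (simp add: nc_series_simps)
    also have "\<dots> = (\<Sum>i\<in>{0, length w}. f (take i w) * g (drop i w))"
      by (rule sum.mono_neutral_right) (use z in auto)
    also have "\<dots> = g w + f w" using ne Nil by simp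
    finally have "g w = - f w" by simp
    moreover have "?e w = 0" using ne by (simp add: nc_series_simps)
    \<comment> \<open>The coefficient of \<open>g\<close> at \<open>w\<close> is negative:
      impossible if \<open>w\<close> precedes \<open>w'\<close>, where it must be 0, and if
      \<open>w = w'\<close>, where it must be positive.\<close>
    ultimately show False using w(1) w' le by fastforce
  qed
  assume "nc_lowest_pos (\<lambda>w. g w - ?e w)"
  then obtain w w' where
    w: "f w - ?e w > 0" "\<And>v. (v, w) \<in> lenlex less_than \<Longrightarrow> f v - ?e v = 0"
    and w': "g w' - ?e w' > 0" "\<And>v. (v, w') \<in> lenlex less_than \<Longrightarrow> g v - ?e v = 0"
    using pos unfolding nc_lowest_pos_def by blast
  have "(w, w') \<in> lenlex less_than \<or> w = w' \<or> (w', w) \<in> lenlex less_than"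
    using total_lenlex[OF total_less_than] by (auto simp: total_on_def)
  then show False
    using no[of f g w w'] no[of g f w' w] inv Nil w w' by blast
qed

section \<open>The Magnus expansion of a free group\<close>

locale free_group_basis = group H for H (structure) +
  fixes n :: nat and x :: "nat \<Rightarrow> 'a"
  assumes basis: "free_basis H n x"
begin

abbreviation "\<mu> \<equiv> magnus H n x"
abbreviation "R \<equiv> nc_series n"

lemma magnus_hom: "\<mu> \<in> hom H (units_of R)"
  and magnus_gen: "i \<in> {1..n} \<Longrightarrow> \<mu> (x i) = \<one>\<^bsub>R\<^esub> \<oplus>\<^bsub>R\<^esub> nc_var i"
  using theI'[OF magnus_unique_existence[OF is_group basis]] unfolding magnus_def by auto

lemma gen_closed: "i \<in> {1..n} \<Longrightarrow> x i \<in> carrier H"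
  using basis by (auto simp: free_basis_def)

lemma magnus_closed: "g \<in> carrier H \<Longrightarrow> \<mu> g \<in> carrier R"
  using magnus_hom by (auto simp: hom_def Pi_iff units_of_carrier Units_def)

lemma magnus_mult:
  "g \<in> carrier H \<Longrightarrow> h \<in> carrier H \<Longrightarrow> \<mu> (g \<otimes> h) = \<mu> g \<otimes>\<^bsub>R\<^esub> \<mu> h"
  using magnus_hom by (auto simp: hom_def units_of_mult)

lemma magnus_one: "\<mu> \<one> = \<one>\<^bsub>R\<^esub>"
proof -
  interpret R: ring R by (rule nc_series_ring)
  show ?thesis
    using hom_one[OF magnus_hom is_group R.units_group] by (simp add: units_of_one)
qed

lemma magnus_inv_mult: "g \<in> carrier H \<Longrightarrow> \<mu> (inv g) \<otimes>\<^bsub>R\<^esub> \<mu> g = \<one>\<^bsub>R\<^esub>"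
  by (metis inv_closed l_inv magnus_mult magnus_one)

text \<open>The constant term is multiplicative and equals 1 on the generators.\<close>

lemma magnus_Nil:
  assumes "g \<in> carrier H"
  shows "\<mu> g [] = 1"
proof -
  have "g \<in> generate H (x ` {1..n})" using assms basis by (simp add: free_basis_def)
  then show ?thesis
  proof (induction rule: generate.induct)
    case one
    then show ?case by (simp add: magnus_one nc_series_simps)
  next
    case (incl h)
    then show ?case by (auto simp: magnus_gen nc_series_simps nc_var_def)
  next
    case (inv h)
    then have "h \<in> carrier H" "\<mu> h [] = 1"
      by (auto simp: gen_closed magnus_gen nc_series_simps nc_var_def)
    then show ?case
      using fun_cong[OF magnus_inv_mult, of h "[]"] by (simp add: nc_mult_Nil, simp add: nc_series_simps)
  next
    case (eng h1 h2)
    have "x ` {1..n} \<subseteq> carrier H" using gen_closed by auto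
    then show ?case
      using eng generate_in_carrier by (simp add: magnus_mult nc_mult_Nil)
  qed
qed

text \<open>With constant terms 1, the linear coefficients add up; for \<open>i\<close> in
  \<open>{1..n}\<close> the coefficient at \<open>[i]\<close> is the exponent sum of
  \<open>x i\<close>.\<close>

lemma magnus_single_mult:
  "g \<in> carrier H \<Longrightarrow> h \<in> carrier H \<Longrightarrow> \<mu> (g \<otimes> h) [i] = \<mu> g [i] + \<mu> h [i]"
  by (simp add: magnus_mult nc_mult_single magnus_Nil)

lemma magnus_single_inv:
  assumes "g \<in> carrier H"
  shows "\<mu> (inv g) [i] = - \<mu> g [i]"
  using magnus_single_mult[of "inv g" g i] assms by (simp add: magnus_one nc_series_simps)

text \<open>A homomorphism into the additive group of integers kills commutators.\<close>

lemma magnus_single_derived: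
  assumes "d \<in> derived H (carrier H)"
  shows "\<mu> d [i] = 0"
  using assms unfolding derived_def
proof (induction rule: generate.induct)
  case one
  then show ?case by (simp add: magnus_one nc_series_simps)
next
  case (incl h)
  then show ?case by (auto simp: magnus_single_mult magnus_single_inv)
next
  case (inv h)
  then show ?case by (auto simp: magnus_single_mult magnus_single_inv)
next
  case (eng h1 h2)
  then have "h1 \<in> carrier H" "h2 \<in> carrier H"
    using generate_in_carrier[OF derived_set_in_carrier] by auto
  then show ?case using eng by (simp add: magnus_single_mult)
qed

lemma magnus_minus_one:
  "g \<in> carrier H \<Longrightarrow> \<mu> g \<ominus>\<^bsub>R\<^esub> \<one>\<^bsub>R\<^esub> = (\<lambda>w. \<mu> g w - \<one>\<^bsub>R\<^esub> w)"
proof -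
  assume g: "g \<in> carrier H"
  interpret R: ring R by (rule nc_series_ring)
  have "(\<lambda>w. \<mu> g w - \<one>\<^bsub>R\<^esub> w) = \<mu> g \<oplus>\<^bsub>R\<^esub> (\<lambda>w. - \<one>\<^bsub>R\<^esub> w)" by (simp add: nc_series_simps)
  moreover have "(\<lambda>w. - \<one>\<^bsub>R\<^esub> w) = \<ominus>\<^bsub>R\<^esub> \<one>\<^bsub>R\<^esub>"
    by (rule R.minus_equality[symmetric]) (auto simp: nc_series_simps)
  ultimately show ?thesis by (simp add: R.minus_eq)
qed

lemma magnus_cone_iff:
  "g \<in> magnus_cone H n x \<longleftrightarrow>
     g \<in> carrier H \<and> g \<noteq> \<one> \<and> nc_lowest_pos (\<lambda>w. \<mu> g w - \<one>\<^bsub>R\<^esub> w)"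
  by (auto simp: magnus_cone_def nc_lowest_pos_def Let_def magnus_minus_one)

lemma magnus_cone_inv:
  assumes "g \<in> magnus_cone H n x"
  shows "inv g \<notin> magnus_cone H n x"
proof -
  have g: "g \<in> carrier H" using assms by (simp add: magnus_cone_iff)
  have "\<mu> g \<otimes>\<^bsub>R\<^esub> \<mu> (inv g) = \<one>\<^bsub>R\<^esub>" using magnus_inv_mult[of "inv g"] g by simp
  then have "\<not> nc_lowest_pos (\<lambda>w. \<mu> (inv g) w - \<one>\<^bsub>R\<^esub> w)"
    using assms g
    by (intro nc_lowest_pos_not_inverse[of n "\<mu> g"]) (simp_all add: magnus_inv_mult magnus_Nil magnus_cone_iff)
  then show ?thesis by (simp add: magnus_cone_iff)
qed

text \<open>The map \<open>\<phi>\<close> acts on Magnus expansions as a substitution. Triviality on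
  the abelianization makes it the identity in lowest degree, so the leading coefficient keeps its
  sign.\<close>

lemma magnus_cone_endomorphism:
  assumes \<phi>: "\<phi> \<in> hom H H" and inj: "inj_on \<phi> (carrier H)"
    and ab: "\<And>g. g \<in> carrier H \<Longrightarrow> \<exists>d\<in>derived H (carrier H). \<phi> g = d \<otimes> g"
    and g: "g \<in> magnus_cone H n x"
  shows "\<phi> g \<in> magnus_cone H n x"
proof -
  interpret R: ring R by (rule nc_series_ring)
  have gH: "g \<in> carrier H" "g \<noteq> \<one>" using g by (auto simp: magnus_cone_iff)
  have \<phi>c: "\<phi> h \<in> carrier H" if "h \<in> carrier H" for h using \<phi> that by (auto simp: hom_def)
  \<comment> \<open>The substitution is forced by the generators: 1 plus the i-th variable must go
    to the expansion of \<open>\<phi> (x i)\<close>.\<close>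
  define Y where "Y i = (\<lambda>w. \<mu> (\<phi> (x i)) w - \<one>\<^bsub>R\<^esub> w)" for i
  have "Y i \<in> carrier R" if "i \<in> {1..n}" for i
    using magnus_closed[OF \<phi>c[OF gen_closed[OF that]]]
    unfolding Y_def nc_series_simps by (metis diff_self empty_set empty_subsetI diff_zero)
  then have Y: "Y \<in> {1..n} \<rightarrow> carrier R" by blast
  have Y0: "Y i [] = 0" if "i \<in> {1..n}" for i
    using that by (simp add: Y_def \<phi>c gen_closed magnus_Nil nc_series_simps)
  have Y1: "Y i [j] = (if i = j then 1 else 0)" if i: "i \<in> {1..n}" for i j
  proof -
    obtain d where d: "d \<in> derived H (carrier H)" "\<phi> (x i) = d \<otimes> x i"
      using ab gen_closed i by blast
    have "d \<in> carrier H" using d(1) derived_in_carrier by auto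
    \<comment> \<open>The factor \<open>d\<close> from the derived subgroup has no linear part; this
      is where the action on the abelianization enters.\<close>
    then have "\<mu> (\<phi> (x i)) [j] = \<mu> (x i) [j]"
      using d i by (simp add: magnus_single_mult gen_closed magnus_single_derived)
    then show ?thesis
      using i by (simp add: Y_def magnus_gen nc_series_simps nc_var_def)
  qed
  have xH: "x \<in> {1..n} \<rightarrow> carrier H" using gen_closed by auto
  have hom1: "\<mu> \<circ> \<phi> \<in> hom H (units_of R)" using \<phi> magnus_hom by (rule Group.hom_compose)
  have hom2: "nc_subst n Y \<circ> \<mu> \<in> hom H (units_of R)"
    using magnus_hom nc_subst_hom_units[OF Y Y0] by (rule Group.hom_compose)
  have gens: "\<forall>i\<in>{1..n}. (nc_subst n Y \<circ> \<mu>) (x i) = (\<mu> \<circ> \<phi>) (x i)"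
  proof
    fix i assume i: "i \<in> {1..n}"
    then have "(nc_subst n Y \<circ> \<mu>) (x i) = \<one>\<^bsub>R\<^esub> \<oplus>\<^bsub>R\<^esub> Y i"
      using i Y Y0 by (simp add: magnus_gen nc_subst_add nc_subst_one nc_subst_var Pi_iff)
    also have "\<dots> = \<mu> (\<phi> (x i))" by (simp add: Y_def nc_series_simps)
    finally show "(nc_subst n Y \<circ> \<mu>) (x i) = (\<mu> \<circ> \<phi>) (x i)" by simp
  qed
  obtain w where w: "w \<in> words n" "word_val H x w = g"
    using free_basis_word[OF is_group basis gH(1)] .
  have im: "(\<lambda>i. (\<mu> \<circ> \<phi>) (x i)) \<in> {1..n} \<rightarrow> carrier (units_of R)"
    using hom1 gen_closed by (auto simp: hom_def)
  \<comment> \<open>Two homomorphisms that agree on the basis agree on every word in it, in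
    particular on a word for \<open>g\<close>.\<close>
  have comm: "\<mu> (\<phi> g) = nc_subst n Y (\<mu> g)"
    using hom_word_val[OF is_group xH R.units_group im hom1 _ w(1)]
      hom_word_val[OF is_group xH R.units_group im hom2 gens w(1)] w(2) by simp
  \<comment> \<open>The cone looks at the expansion minus 1; splitting off 1, which substitution
    fixes, transfers \<open>comm\<close> to this difference by additivity.\<close>
  define f where "f = (\<lambda>w. \<mu> g w - \<one>\<^bsub>R\<^esub> w)"
  have "f = \<mu> g \<ominus>\<^bsub>R\<^esub> \<one>\<^bsub>R\<^esub>" using gH by (simp add: f_def magnus_minus_one)
  then have f: "f \<in> carrier R" using magnus_closed[OF gH(1)] by simp
  have \<mu>g: "\<mu> g = \<one>\<^bsub>R\<^esub> \<oplus>\<^bsub>R\<^esub> f" by (simp add: f_def nc_series_simps)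
  have "nc_lowest_pos (nc_subst n Y f)"
    using g gH by (intro nc_lowest_pos_subst[OF Y0 Y1 f])
      (simp_all add: f_def magnus_cone_iff)
  moreover have "nc_subst n Y f = (\<lambda>w. \<mu> (\<phi> g) w - \<one>\<^bsub>R\<^esub> w)"
    unfolding comm \<mu>g nc_subst_add nc_subst_one by (simp add: nc_series_simps)
  \<comment> \<open>Injectivity keeps the image nontrivial, as membership in the cone
    demands.\<close>
  moreover have "\<phi> g \<noteq> \<one>"
    using inj_onD[OF inj, of g \<one>] gH hom_one[OF \<phi> is_group is_group] by auto
  ultimately show ?thesis using \<phi>c[OF gH(1)] by (simp add: magnus_cone_iff)
qed

end

section \<open>Convexity for iterated semidirect products\<close>

lemma (in group) cancel_inv_left:
  assumes "a \<in> carrier G" "b \<in> carrier G"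
  shows "a \<otimes> (inv a \<otimes> b) = b" "inv a \<otimes> (a \<otimes> b) = b"
  using assms by (simp_all add: m_assoc[symmetric])

lemma (in group) conj_eq_one:
  assumes "a \<in> carrier G" "f \<in> carrier G" "a \<otimes> f \<otimes> inv a = \<one>"
  shows "f = \<one>"
proof -
  have "a \<otimes> f \<otimes> inv a \<otimes> a = a" using assms by simp
  then show ?thesis using assms(1,2) by (simp add: m_assoc)
qed

locale iterated_semidirect_group = group G for G (structure) +
  fixes k :: nat and F :: "nat \<Rightarrow> 'a set"
  assumes iterated: "iterated_semidirect G k F"
begin

abbreviation "S \<equiv> stage G F"

lemma factor_subgroup: "i \<in> {1..k} \<Longrightarrow> subgroup (F i) G"
  using iterated by (simp add: iterated_semidirect_def)

text \<open>The semidirect condition starts at the second factor, hence \<open>i \<noteq> 0\<close>;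
  the step from the trivial stage 0 to stage 1 is treated separately below.\<close>

lemma semidirect_step:
  assumes "Suc i \<le> k" "i \<noteq> 0"
  shows "F (Suc i) \<lhd> G\<lparr>carrier := S (Suc i)\<rparr>" "subgroup (S i) (G\<lparr>carrier := S (Suc i)\<rparr>)"
    "F (Suc i) \<inter> S i = {\<one>}"
proof -
  have "\<forall>j\<in>{2..k}. internal_semidirect (G\<lparr>carrier := S j\<rparr>) (F j) (S (j - 1))"
    using iterated unfolding iterated_semidirect_def by blast
  moreover have "Suc i \<in> {2..k}" using assms by auto
  ultimately have "internal_semidirect (G\<lparr>carrier := S (Suc i)\<rparr>) (F (Suc i)) (S (Suc i - 1))"
    by blast
  then show "F (Suc i) \<lhd> G\<lparr>carrier := S (Suc i)\<rparr>" "subgroup (S i) (G\<lparr>carrier := S (Suc i)\<rparr>)"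
    "F (Suc i) \<inter> S i = {\<one>}"
    unfolding internal_semidirect_def by (simp_all del: stage.simps)
qed

text \<open>Downward induction from the whole group: each stage is known to be a subgroup only
  inside the next one.\<close>

lemma stage_subgroup: "i \<le> k \<Longrightarrow> subgroup (S i) G"
proof (induction rule: inc_induct)
  case base
  have "S k = carrier G" using iterated by (simp add: iterated_semidirect_def)
  then show ?case using subgroup_self by simp
next
  case (step i)
  show ?case
  proof (cases "i = 0")
    case False
    then show ?thesis using semidirect_step(2)[of i] step incl_subgroup by simp
  qed (simp add: triv_subgroup)
qed

lemma stage_closed: "i \<le> k \<Longrightarrow> a \<in> S i \<Longrightarrow> a \<in> carrier G"
  using stage_subgroup subgroup.mem_carrier by metis

lemma factor_closed: "i \<in> {1..k} \<Longrightarrow> a \<in> F i \<Longrightarrow> a \<in> carrier G"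
  using factor_subgroup subgroup.mem_carrier by metis

lemma stage_subset_Suc:
  assumes "Suc i \<le> k"
  shows "S i \<subseteq> S (Suc i)"
proof
  fix a assume a: "a \<in> S i"
  have "\<one> \<in> F (Suc i)" using assms by (simp add: subgroup.one_closed[OF factor_subgroup])
  then have "\<one> \<otimes> a \<in> S (Suc i)" using a by (auto simp: set_mult_def)
  then show "a \<in> S (Suc i)" using a assms stage_closed[of i a] by simp
qed

lemma stage_mono: "i \<le> j \<Longrightarrow> j \<le> k \<Longrightarrow> S i \<subseteq> S j"
proof (induction rule: dec_induct)
  case (step i)
  then show ?case using stage_subset_Suc[of i] by (meson Suc_leD order_trans)
qed simp

lemma factor_inter_stage: "Suc i \<le> k \<Longrightarrow> F (Suc i) \<inter> S i = {\<one>}"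
  by (cases "i = 0") (simp_all add: semidirect_step(3) subgroup.one_closed[OF factor_subgroup])

text \<open>Normality of the factor in its own stage; for \<open>i = 0\<close> the only conjugating
  element is the identity.\<close>

lemma factor_conj:
  assumes i: "Suc i \<le> k" and a: "a \<in> S i" and f: "f \<in> F (Suc i)"
  shows "a \<otimes> f \<otimes> inv a \<in> F (Suc i)"
proof (cases "i = 0")
  case False
  have "a \<in> S (Suc i)" using stage_subset_Suc[OF i] a by blast
  then show ?thesis
    using normal.inv_op_closed2[OF semidirect_step(1)[OF i False], of a f] f
      m_inv_consistent[OF stage_subgroup[OF i]] by simp
qed (use assms factor_closed[of "Suc i"] in simp)

section \<open>Normal forms and their top factors\<close>

lemma desc_prod_stage: "\<forall>i\<in>{1..m}. c i \<in> F i \<Longrightarrow> desc_prod G c m \<in> S m"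
  by (induction m) (auto simp: set_mult_def)

lemma desc_prod_trailing_ones:
  assumes "m \<le> k" "\<forall>i\<in>{1..k}. c i \<in> F i" "\<forall>i\<in>{m<..k}. c i = \<one>"
  shows "desc_prod G c k = desc_prod G c m"
  using assms
proof (induction rule: inc_induct)
  case (step i)
  then have "desc_prod G c i \<in> carrier G"
    by (intro stage_closed[of i] desc_prod_stage) auto
  then show ?case using step by auto
qed simp

text \<open>The quotient \<open>inv b \<otimes> a\<close> equals \<open>s \<otimes> inv r\<close>,
  so it lies in the trivial intersection of the factor with the lower stage.\<close>

lemma top_factor_unique:
  assumes "Suc m \<le> k" "a \<in> F (Suc m)" "b \<in> F (Suc m)" "r \<in> S m" "s \<in> S m" "a \<otimes> r = b \<otimes> s"
  shows "a = b"
proof -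
  have c: "a \<in> carrier G" "b \<in> carrier G" "r \<in> carrier G" "s \<in> carrier G"
    using assms stage_closed[of m] factor_closed[of "Suc m"] by auto
  have "inv b \<otimes> a = s \<otimes> inv r"
  proof -
    have "inv b \<otimes> a = inv b \<otimes> (a \<otimes> r) \<otimes> inv r" using c by (simp add: m_assoc)
    also have "\<dots> = s \<otimes> inv r" using c assms(6) by (simp add: cancel_inv_left)
    finally show ?thesis .
  qed
  moreover have "inv b \<otimes> a \<in> F (Suc m)"
    using assms factor_subgroup[of "Suc m"] by (simp add: subgroup_def)
  moreover have "s \<otimes> inv r \<in> S m"
    using assms stage_subgroup[of m] by (simp add: subgroup_def)
  ultimately have "inv b \<otimes> a = \<one>" using factor_inter_stage[OF assms(1)] by auto
  then have "b \<otimes> (inv b \<otimes> a) = b" using c by simp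
  then show ?thesis using c by (simp add: cancel_inv_left)
qed

text \<open>Since no \<open>P i\<close> contains the identity, the positive factor in a normal form
  witnessing cone membership is its top nontrivial factor, and this must be
  \<open>a\<close>.\<close>

lemma lex_cone_top_factor:
  assumes P: "\<And>i. i \<in> {1..k} \<Longrightarrow> \<one> \<notin> P i"
    and m: "Suc m \<le> k" "a \<in> F (Suc m)" "a \<noteq> \<one>" "r \<in> S m"
    and g: "a \<otimes> r \<in> lex_cone G k F P"
  shows "a \<in> P (Suc m)"
proof -
  obtain c j where c: "\<forall>i\<in>{1..k}. c i \<in> F i" "a \<otimes> r = desc_prod G c k"
    and j: "j \<in> {1..k}" "c j \<in> P j" "\<forall>i\<in>{j<..k}. c i = \<one>"
    using g by (auto simp: lex_cone_def)
  obtain l where l: "j = Suc l" using j(1) by (cases j) auto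
  define s where "s = desc_prod G c l"
  have s: "s \<in> S l" unfolding s_def using c(1) j(1) l by (intro desc_prod_stage) auto
  have eq: "a \<otimes> r = c j \<otimes> s"
    using desc_prod_trailing_ones[of j c] c j l by (simp add: s_def)
  have cj: "c j \<in> F j" "c j \<noteq> \<one>" using c(1) j P by auto
  \<comment> \<open>Otherwise \<open>b \<otimes> t\<close> would also decompose with top factor
    \<open>\<one>\<close>, contradicting uniqueness.\<close>
  have not_stage: "b \<otimes> t \<notin> S i" if "Suc i \<le> k" "b \<in> F (Suc i)" "b \<noteq> \<one>" "t \<in> S i" for i b t
  proof
    assume "b \<otimes> t \<in> S i"
    moreover have "\<one> \<in> F (Suc i)" "b \<otimes> t \<in> carrier G"
      using that factor_subgroup[of "Suc i"] stage_closed[of i] factor_closed[of "Suc i"]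
      by (auto simp: subgroup.one_closed)
    ultimately show False using top_factor_unique[of i b \<one> t "b \<otimes> t"] that by simp
  qed
  have "a \<otimes> r \<in> S (Suc m)" "c j \<otimes> s \<in> S j"
    using m cj s l by (auto simp: set_mult_def)
  then have in_stage: "a \<otimes> r \<in> S (Suc m)" "a \<otimes> r \<in> S j" using eq by simp_all
  \<comment> \<open>If the two top indices differ, the decomposition with the larger index has a
    nontrivial top factor although the element lies in a lower stage.\<close>
  consider "m < l" | "m = l" | "l < m" by linarith
  then show ?thesis
  proof cases
    case 1
    then have "a \<otimes> r \<in> S l" using in_stage(1) stage_mono[of "Suc m" l] j l by auto
    then show ?thesis using not_stage[of l "c j" s] eq cj s j l by simp
  next
    case 2
    then have "a = c j" using top_factor_unique[of m a "c j" r s] m cj s eq l by simp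
    then show ?thesis using j l 2 by simp
  next
    case 3
    then have "a \<otimes> r \<in> S m" using in_stage(2) stage_mono[of j m] m l by auto
    then show ?thesis using not_stage m by simp
  qed
qed

text \<open>Asymmetry and conjugation invariance of the factor cones are what the argument draws on;
  for Magnus cones the invariance comes from the almost-direct condition.\<close>

lemma lex_cone_convex:
  assumes one: "\<And>i. i \<in> {1..k} \<Longrightarrow> \<one> \<notin> P i"
    and asym: "\<And>i f. i \<in> {1..k} \<Longrightarrow> f \<in> P i \<Longrightarrow> inv f \<notin> P i"
    and conj: "\<And>i a f. i \<in> {2..k} \<Longrightarrow> a \<in> S (i - 1) \<Longrightarrow> f \<in> F i \<Longrightarrow> f \<in> P i \<Longrightarrow> a \<otimes> f \<otimes> inv a \<in> P i"
    and j: "j \<in> {1..k}"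
  shows "convex_subgroup G (cone_less G (lex_cone G k F P)) (S j)"
  unfolding convex_subgroup_def
proof (intro conjI ballI impI)
  show "subgroup (S j) G" using stage_subgroup j by simp
  fix h1 h2 g
  assume h: "h1 \<in> S j" "h2 \<in> S j" and g: "g \<in> carrier G"
    and lt: "cone_less G (lex_cone G k F P) h1 g \<and> cone_less G (lex_cone G k F P) g h2"
  show "g \<in> S j"
  proof (rule ccontr)
    assume nj: "g \<notin> S j"
    have "g \<in> S k" using g iterated by (simp add: iterated_semidirect_def)
    \<comment> \<open>The stage at which \<open>g\<close> enters the chain on the way from
      \<open>j\<close> to \<open>k\<close>; its factor there is the top nontrivial one.\<close>
    have "\<exists>m. Suc m \<le> k \<and> j \<le> m \<and> g \<in> S (Suc m) \<and> g \<notin> S m"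
    proof (rule ccontr)
      assume no: "\<not> ?thesis"
      have "j \<le> k" using j by simp
      then have "g \<notin> S k"
      proof (induction rule: dec_induct)
        case (step i)
        then show ?case using no by (meson Suc_leI)
      qed (fact nj)
      then show False using \<open>g \<in> S k\<close> by simp
    qed
    then obtain m where m: "Suc m \<le> k" "j \<le> m" "g \<in> S (Suc m)" "g \<notin> S m" by blast
    have Sm: "subgroup (S m) G" and Fm: "subgroup (F (Suc m)) G"
      using stage_subgroup factor_subgroup m(1) by auto
    obtain c r where cr: "c \<in> F (Suc m)" "r \<in> S m" "g = c \<otimes> r"
      using m(3) by (auto simp: set_mult_def)
    have cl: "c \<in> carrier G" "r \<in> carrier G"
      using cr m(1) stage_closed[of m] factor_closed[of "Suc m"] by auto
    have c1: "c \<noteq> \<one>" using cr m(4) cl by auto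
    have hm: "h1 \<in> S m" "h2 \<in> S m" using h stage_mono[of j m] m by auto
    have hc: "h1 \<in> carrier G" "h2 \<in> carrier G" using hm m(1) stage_closed[of m] by auto
    have conj_ne: "a \<otimes> f \<otimes> inv a \<noteq> \<one>" if "a \<in> carrier G" "f \<in> carrier G" "f \<noteq> \<one>" for a f
      using that conj_eq_one by blast
    \<comment> \<open>Invariance under \<open>inv a\<close> carries positivity back from the
      conjugate. From \<open>1 \<le> j\<close> and \<open>j \<le> m\<close> the index
      \<open>Suc m\<close> is at least 2, where \<open>conj\<close> applies.\<close>
    have conj_cancel: "f \<in> P (Suc m)"
      if a: "a \<in> S m" and f: "f \<in> F (Suc m)" and p: "a \<otimes> f \<otimes> inv a \<in> P (Suc m)" for a f
    proof -
      have ac: "a \<in> carrier G" "f \<in> carrier G"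
        using a f m(1) stage_closed[of m] factor_closed[of "Suc m"] by auto
      have "inv a \<otimes> (a \<otimes> f \<otimes> inv a) \<otimes> inv (inv a) \<in> P (Suc m)"
        using conj[of "Suc m" "inv a"] p a f m j factor_conj subgroup.m_inv_closed[OF Sm] by simp
      moreover have "inv a \<otimes> (a \<otimes> f \<otimes> inv a) \<otimes> inv (inv a) = f"
        using ac by (simp add: m_assoc cancel_inv_left)
      ultimately show ?thesis by simp
    qed
    \<comment> \<open>Rewritten as an element of \<open>F (Suc m)\<close> times one of
      \<open>S m\<close>, so that the top factor of the positive element can be read off.\<close>
    have "inv h1 \<otimes> g = inv h1 \<otimes> c \<otimes> inv (inv h1) \<otimes> (inv h1 \<otimes> r)"
      using cl hc cr(3) by (simp add: m_assoc cancel_inv_left)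
    then have "inv h1 \<otimes> c \<otimes> inv (inv h1) \<in> P (Suc m)"
      using lt cl hc hm cr m c1 conj_ne subgroup.m_inv_closed[OF Sm] subgroup.m_closed[OF Sm]
      by (intro lex_cone_top_factor[OF one, where r = "inv h1 \<otimes> r"] factor_conj)
        (auto simp: cone_less_def)
    then have "c \<in> P (Suc m)"
      using conj_cancel[of "inv h1" c] hm cr subgroup.m_inv_closed[OF Sm] by blast
    \<comment> \<open>The same regrouping; inverting \<open>g\<close> reverses the order, so the
      conjugating element is now \<open>inv r\<close> instead of \<open>inv h1\<close>.\<close>
    moreover have "inv g \<otimes> h2 = inv r \<otimes> inv c \<otimes> inv (inv r) \<otimes> (inv r \<otimes> h2)"
      using cl hc cr(3) by (simp add: inv_mult_group m_assoc cancel_inv_left)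
    then have "inv r \<otimes> inv c \<otimes> inv (inv r) \<in> P (Suc m)"
      using lt cl hc hm cr m c1 conj_ne subgroup.m_inv_closed[OF Sm] subgroup.m_inv_closed[OF Fm]
        subgroup.m_closed[OF Sm]
      by (intro lex_cone_top_factor[OF one, where r = "inv r \<otimes> h2"] factor_conj)
        (auto simp: cone_less_def)
    then have "inv c \<in> P (Suc m)"
      using conj_cancel[of "inv r" "inv c"] cr subgroup.m_inv_closed[OF Sm] subgroup.m_inv_closed[OF Fm]
      by blast
    ultimately show False using asym[of "Suc m" c] m(1) by simp
  qed
qed

end

section \<open>Almost-direct products with Magnus cones\<close>

theorem proposition8:
  fixes G :: "('a, 'b) monoid_scheme"
    and k :: nat
    and F :: "nat \<Rightarrow> 'a set"
    and n :: "nat \<Rightarrow> nat"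
    and x :: "nat \<Rightarrow> nat \<Rightarrow> 'a"
    and P :: "'a set"
  assumes "almost_direct G k F"
    and "\<And>i. i \<in> {1..k} \<Longrightarrow> free_basis (G\<lparr>carrier := F i\<rparr>) (n i) (x i)"
    and "P = lex_cone G k F (\<lambda>i. magnus_cone (G\<lparr>carrier := F i\<rparr>) (n i) (x i))"
    and "j \<in> {1..k}"
  shows "convex_subgroup G (cone_less G P) (stage G F j)"
proof -
  have iter: "iterated_semidirect G k F" using assms(1) by (simp add: almost_direct_def)
  then interpret group G by (simp add: iterated_semidirect_def)
  interpret iterated_semidirect_group G k F by unfold_locales (fact iter)
  have free: "free_group_basis (G\<lparr>carrier := F i\<rparr>) (n i) (x i)" if "i \<in> {1..k}" for i
    using subgroup.subgroup_is_group[OF factor_subgroup[OF that] is_group] assms(2)[OF that]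
    by (simp add: free_group_basis_def free_group_basis_axioms_def)
  show ?thesis unfolding assms(3)
  proof (rule lex_cone_convex)
    fix i assume i: "i \<in> {1..k}"
    interpret Fi: free_group_basis "G\<lparr>carrier := F i\<rparr>" "n i" "x i" by (rule free[OF i])
    show "\<one>\<^bsub>G\<^esub> \<notin> magnus_cone (G\<lparr>carrier := F i\<rparr>) (n i) (x i)" by (simp add: Fi.magnus_cone_iff)
    fix f assume f: "f \<in> magnus_cone (G\<lparr>carrier := F i\<rparr>) (n i) (x i)"
    then have "f \<in> F i" by (simp add: Fi.magnus_cone_iff)
    then show "inv\<^bsub>G\<^esub> f \<notin> magnus_cone (G\<lparr>carrier := F i\<rparr>) (n i) (x i)"
      using Fi.magnus_cone_inv[OF f] m_inv_consistent[OF factor_subgroup[OF i]] by simp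
  next
    fix i a f assume i: "i \<in> {2..k}" and a: "a \<in> stage G F (i - 1)"
      and f: "f \<in> magnus_cone (G\<lparr>carrier := F i\<rparr>) (n i) (x i)"
    obtain l where l: "i = Suc l" "Suc l \<le> k" using i by (cases i) auto
    have i1: "i \<in> {1..k}" using i by auto
    interpret Fi: free_group_basis "G\<lparr>carrier := F i\<rparr>" "n i" "x i" by (rule free[OF i1])
    have ac: "a \<in> carrier G" using a l stage_closed[of l] by simp
    have Fc: "g \<in> carrier G" if "g \<in> F i" for g using factor_closed[OF i1 that] .
    show "a \<otimes>\<^bsub>G\<^esub> f \<otimes>\<^bsub>G\<^esub> inv\<^bsub>G\<^esub> a \<in> magnus_cone (G\<lparr>carrier := F i\<rparr>) (n i) (x i)"
    \<comment> \<open>The endomorphism of \<open>F i\<close> is conjugation by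
      \<open>a\<close>.\<close>
    proof (rule Fi.magnus_cone_endomorphism[OF _ _ _ f])
      show "(\<lambda>g. a \<otimes>\<^bsub>G\<^esub> g \<otimes>\<^bsub>G\<^esub> inv\<^bsub>G\<^esub> a) \<in> hom (G\<lparr>carrier := F i\<rparr>) (G\<lparr>carrier := F i\<rparr>)"
      proof (rule homI, simp_all)
        fix g assume "g \<in> F i"
        then show "a \<otimes>\<^bsub>G\<^esub> g \<otimes>\<^bsub>G\<^esub> inv\<^bsub>G\<^esub> a \<in> F i" using factor_conj[of l a g] a l by simp
      next
        fix g h assume "g \<in> F i" "h \<in> F i"
        then have "g \<in> carrier G" "h \<in> carrier G" by (auto intro: Fc)
        then show "a \<otimes>\<^bsub>G\<^esub> (g \<otimes>\<^bsub>G\<^esub> h) \<otimes>\<^bsub>G\<^esub> inv\<^bsub>G\<^esub> a = a \<otimes>\<^bsub>G\<^esub> g \<otimes>\<^bsub>G\<^esub> inv\<^bsub>G\<^esub> a \<otimes>\<^bsub>G\<^esub> (a \<otimes>\<^bsub>G\<^esub> h \<otimes>\<^bsub>G\<^esub> inv\<^bsub>G\<^esub> a)"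
          using ac by (simp add: m_assoc cancel_inv_left)
      qed
      show "inj_on (\<lambda>g. a \<otimes>\<^bsub>G\<^esub> g \<otimes>\<^bsub>G\<^esub> inv\<^bsub>G\<^esub> a) (carrier (G\<lparr>carrier := F i\<rparr>))"
        using ac Fc by (auto intro!: inj_onI)
      fix g assume "g \<in> carrier (G\<lparr>carrier := F i\<rparr>)"
      then have g: "g \<in> F i" by simp
      have sub: "subgroup (derived G (F i)) G"
        using derived_is_subgroup[OF subgroup.subset[OF factor_subgroup[OF i1]]] .
      have "derived G (F i) #>\<^bsub>G\<^esub> (a \<otimes>\<^bsub>G\<^esub> g \<otimes>\<^bsub>G\<^esub> inv\<^bsub>G\<^esub> a) = derived G (F i) #>\<^bsub>G\<^esub> g"
        using conjunct2[OF assms(1)[unfolded almost_direct_def], rule_format, OF i a g] .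
      \<comment> \<open>A conjugate lies in its own coset, hence in that of \<open>g\<close>; this
        yields the required factor \<open>d\<close>.\<close>
      then have "a \<otimes>\<^bsub>G\<^esub> g \<otimes>\<^bsub>G\<^esub> inv\<^bsub>G\<^esub> a \<in> derived G (F i) #>\<^bsub>G\<^esub> g"
        using rcos_self[OF _ sub, of "a \<otimes>\<^bsub>G\<^esub> g \<otimes>\<^bsub>G\<^esub> inv\<^bsub>G\<^esub> a"] ac Fc[OF g] by simp
      \<comment> \<open>The derived subgroup of \<open>F i\<close> is the same whether formed in
        \<open>G\<close> or in \<open>F i\<close> as a group of its own.\<close>
      then show "\<exists>d\<in>derived (G\<lparr>carrier := F i\<rparr>) (carrier (G\<lparr>carrier := F i\<rparr>)).
          a \<otimes>\<^bsub>G\<^esub> g \<otimes>\<^bsub>G\<^esub> inv\<^bsub>G\<^esub> a = d \<otimes>\<^bsub>G\<lparr>carrier := F i\<rparr>\<^esub> g"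
        using derived_consistent[OF subset_refl factor_subgroup[OF i1]] by (auto simp: r_coset_def)
    qed
  qed (fact assms(4))
qed

end
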